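(* Let $P$ be a normal fuzzy logic program over a complete lattice $(V,\leqslant)$ and a set of atoms $\Pi$, and let $\Pi_1,\Pi_2$ be a partition of $\Pi$. If $P$ is stratifiable over $\Pi_1,\Pi_2$, then $\mathcal{T}_P$ is stratifiable over $\Pi_1,\Pi_2$; that is, for all $(L^1,U^1),(L^2,U^2)\in\mathcal{I}^2$, if $(L^1,U^1)_{|\Pi_1}=(L^2,U^2)_{|\Pi_1}$ then $\mathcal{T}_P(L^1,U^1)_{|\Pi_1}=\mathcal{T}_P(L^2,U^2)_{|\Pi_1}$.
   Context: Setting. $(V,\leqslant)$ is a complete lattice of truth values with least element $0$ and greatest element $1$; $V'\subseteq V$ is a designated subset of truth values allowed as constants and weights; $\Pi$ is a set of atoms. Each $n$-ary connective $f$ has a truth function $f^{\cdot}\colon V^n\to V$. Truth functions of conjunctors, disjunctors and aggregators are monotone in each argument; a conjunctor $\&$ satisfies $x\mathbin{\&^{\cdot}}y\leqslant x$, $x\mathbin{\&^{\cdot}}y\leqslant y$, $x\mathbin{\&^{\cdot}}1=x=1\mathbin{\&^{\cdot}}x$; a disjunctor $|$ satisfies $x\leqslant x\mathbin{|^{\cdot}}y$, $y\leqslant x\mathbin{|^{\cdot}}y$, $x\mathbin{|^{\cdot}}0=x=0\mathbin{|^{\cdot}}x$. Each implicator $\leftarrow_i$ is paired with a conjunctor $\wedge_i$ (its adjoint partner). Default negation $\sim$ has a truth function $\sim^{\cdot}\colon V\to V$ that is an antimonotone involution. Normal fuzzy formulas are built from constants $c\in V'$, atoms $p$ and negated atoms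 $\sim p$ ($p\in\Pi$) using conjunctors, disjunctors and aggregators. A normal fuzzy logic program $P$ is a finite set of rules $p\leftarrow_i^{\vartheta}\mathcal{B}$ with head $p\in\Pi$, weight $\vartheta\in V'$ and body $\mathcal{B}$ a normal fuzzy formula. $\mathcal{I}$ is the set of interpretations $I\colon\Pi\to V$, ordered pointwise. Evaluation under a pair $(L,U)\in\mathcal{I}^2$: $\widehat{(L,U)}(c)=c$, $\widehat{(L,U)}(p)=L(p)$, $\widehat{(L,U)}(\sim p)=\sim^{\cdot}U(p)$, and $\widehat{(L,U)}(f(\varphi_1,\dots,\varphi_n))=f^{\cdot}(\widehat{(L,U)}(\varphi_1),\dots,\widehat{(L,U)}(\varphi_n))$. The operator $\mathcal{T}_P\colon\mathcal{I}^2\to\mathcal{I}^2$ is $\mathcal{T}_P(L,U)_1(p)=\bigvee\{\vartheta\wedge_i^{\cdot}\widehat{(L,U)}(\mathcal{B}) : p\leftarrow_i^{\vartheta}\mathcal{B}\in P\}$, $\mathcal{T}_P(L,U)_2=\mathcal{T}_P(U,L)_1$ (subscripts denote components). For $\Pi'\subseteq\Pi$, $I_{|\Pi'}$ is the restriction of $I$ to $\Pi'$ and $(L,U)_{|\Pi'}=(L_{|\Pi'},U_{|\Pi'})$. For atoms $p,q$, write $q\preceq_P p$ iff there is a rule $p\leftarrow_i^{\vartheta}\mathcal{B}\in P$ such that $q$ occurs (positively or negated) in $\mathcal{B}$. $P$ is stratifiable over the partition $\Pi_1,\Pi_2$ iff $q\preceq_P p$, $q\in\Pi_i$ and $p\in\Pi_j$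 imply $i\leq j$. *)

theory Defs
  imports Main "HOL-Library.FuncSet"
begin

text \<open>
  The lattice of truth values is a type \<open>'v :: complete_lattice\<close>, with \<open>0 = bot\<close> and \<open>1 = top\<close>.
  The set of atoms is the type \<open>'a\<close>, so interpretations are functions \<open>'a \<Rightarrow> 'v\<close>.
  Connective symbols are drawn from a type \<open>'c\<close>; the truth function of an \<open>n\<close>-ary symbol is
  only relevant on lists of length \<open>n\<close>.  The field \<open>weights\<close> is the designated set \<open>V'\<close> of truth
  values allowed as constants and as rule weights.
\<close>

record ('c, 'v) fuzzy_language =
  conjunctors :: "'c set"
  disjunctors :: "'c set"
  aggregators :: "'c set"
  implicators :: "'c set"
  arity :: "'c \<Rightarrow> nat"
  truth :: "'c \<Rightarrow> 'v list \<Rightarrow> 'v"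
  partner :: "'c \<Rightarrow> 'c"
  negation :: "'v \<Rightarrow> 'v"
  weights :: "'v set"

definition monotone_in_each_argument :: "nat \<Rightarrow> ('v::order list \<Rightarrow> 'v) \<Rightarrow> bool" where
  "monotone_in_each_argument n f \<longleftrightarrow>
     (\<forall>xs i x y. length xs = n \<and> i < n \<and> x \<le> y \<longrightarrow> f (xs[i := x]) \<le> f (xs[i := y]))"

definition is_conjunctor :: "nat \<Rightarrow> ('v::complete_lattice list \<Rightarrow> 'v) \<Rightarrow> bool" where
  "is_conjunctor n f \<longleftrightarrow> n = 2 \<and> monotone_in_each_argument n f \<and>
     (\<forall>x y. f [x, y] \<le> x \<and> f [x, y] \<le> y) \<and>
     (\<forall>x. f [x, top] = x \<and> f [top, x] = x)"

definition is_disjunctor :: "nat \<Rightarrow> ('v::complete_lattice list \<Rightarrow> 'v) \<Rightarrow> bool" where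
  "is_disjunctor n f \<longleftrightarrow> n = 2 \<and> monotone_in_each_argument n f \<and>
     (\<forall>x y. x \<le> f [x, y] \<and> y \<le> f [x, y]) \<and>
     (\<forall>x. f [x, bot] = x \<and> f [bot, x] = x)"

text \<open>
  The arguments of an implicator are listed as written in a rule: head first, then body.
  The weight is the first argument of the conjunctor, as in the immediate consequence operator.
\<close>

definition adjoint_pair :: "('v::complete_lattice list \<Rightarrow> 'v) \<Rightarrow> ('v list \<Rightarrow> 'v) \<Rightarrow> bool" where
  "adjoint_pair g h \<longleftrightarrow> (\<forall>x y z. g [x, y] \<le> z \<longleftrightarrow> x \<le> h [z, y])"

definition is_default_negation :: "('v::complete_lattice \<Rightarrow> 'v) \<Rightarrow> bool" where
  "is_default_negation neg \<longleftrightarrow> antimono neg \<and> (\<forall>x. neg (neg x) = x)"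

definition fuzzy_language :: "('c, 'v::complete_lattice) fuzzy_language \<Rightarrow> bool" where
  "fuzzy_language \<L> \<longleftrightarrow>
     (\<forall>f \<in> conjunctors \<L>. is_conjunctor (arity \<L> f) (truth \<L> f)) \<and>
     (\<forall>f \<in> disjunctors \<L>. is_disjunctor (arity \<L> f) (truth \<L> f)) \<and>
     (\<forall>f \<in> aggregators \<L>. monotone_in_each_argument (arity \<L> f) (truth \<L> f)) \<and>
     (\<forall>i \<in> implicators \<L>. arity \<L> i = 2 \<and> partner \<L> i \<in> conjunctors \<L> \<and>
        adjoint_pair (truth \<L> (partner \<L> i)) (truth \<L> i)) \<and>
     is_default_negation (negation \<L>)"

datatype ('c, 'a, 'v) formula =
    Const 'v
  | Atom 'a
  | NegAtom 'a
  | Conn 'c "('c, 'a, 'v) formula list"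

fun normal_formula :: "('c, 'v) fuzzy_language \<Rightarrow> ('c, 'a, 'v) formula \<Rightarrow> bool" where
  "normal_formula \<L> (Const c) \<longleftrightarrow> c \<in> weights \<L>"
| "normal_formula \<L> (Atom p) \<longleftrightarrow> True"
| "normal_formula \<L> (NegAtom p) \<longleftrightarrow> True"
| "normal_formula \<L> (Conn f \<phi>s) \<longleftrightarrow>
     f \<in> conjunctors \<L> \<union> disjunctors \<L> \<union> aggregators \<L> \<and>
     length \<phi>s = arity \<L> f \<and> (\<forall>\<phi> \<in> set \<phi>s. normal_formula \<L> \<phi>)"

fun atoms_of :: "('c, 'a, 'v) formula \<Rightarrow> 'a set" where
  "atoms_of (Const c) = {}"
| "atoms_of (Atom p) = {p}"
| "atoms_of (NegAtom p) = {p}"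
| "atoms_of (Conn f \<phi>s) = (\<Union>\<phi> \<in> set \<phi>s. atoms_of \<phi>)"

datatype ('c, 'a, 'v) rule =
  Rule (head: 'a) (implicator: 'c) (weight: 'v) (body: "('c, 'a, 'v) formula")

definition normal_fuzzy_program ::
    "('c, 'v) fuzzy_language \<Rightarrow> ('c, 'a, 'v) rule set \<Rightarrow> bool" where
  "normal_fuzzy_program \<L> P \<longleftrightarrow> finite P \<and>
     (\<forall>r \<in> P. implicator r \<in> implicators \<L> \<and> weight r \<in> weights \<L> \<and> normal_formula \<L> (body r))"

type_synonym ('a, 'v) interp = "'a \<Rightarrow> 'v"

fun eval_formula ::
    "('c, 'v) fuzzy_language \<Rightarrow> ('a, 'v) interp \<times> ('a, 'v) interp \<Rightarrow> ('c, 'a, 'v) formula \<Rightarrow> 'v" where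
  "eval_formula \<L> (L, U) (Const c) = c"
| "eval_formula \<L> (L, U) (Atom p) = L p"
| "eval_formula \<L> (L, U) (NegAtom p) = negation \<L> (U p)"
| "eval_formula \<L> (L, U) (Conn f \<phi>s) = truth \<L> f (map (eval_formula \<L> (L, U)) \<phi>s)"

definition consequence ::
    "('c, 'v::complete_lattice) fuzzy_language \<Rightarrow> ('c, 'a, 'v) rule set \<Rightarrow>
     ('a, 'v) interp \<times> ('a, 'v) interp \<Rightarrow> ('a, 'v) interp" where
  "consequence \<L> P LU p =
     Sup {truth \<L> (partner \<L> i) [\<theta>, eval_formula \<L> LU B] | i \<theta> B. Rule p i \<theta> B \<in> P}"

definition T_op ::
    "('c, 'v::complete_lattice) fuzzy_language \<Rightarrow> ('c, 'a, 'v) rule set \<Rightarrow>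
     ('a, 'v) interp \<times> ('a, 'v) interp \<Rightarrow> ('a, 'v) interp \<times> ('a, 'v) interp" where
  "T_op \<L> P = (\<lambda>(L, U). (consequence \<L> P (L, U), consequence \<L> P (U, L)))"

definition restrict_pair ::
    "('a, 'v) interp \<times> ('a, 'v) interp \<Rightarrow> 'a set \<Rightarrow> ('a, 'v) interp \<times> ('a, 'v) interp" where
  "restrict_pair LU A = (restrict (fst LU) A, restrict (snd LU) A)"

definition depends :: "('c, 'a, 'v) rule set \<Rightarrow> 'a \<Rightarrow> 'a \<Rightarrow> bool" where
  "depends P q p \<longleftrightarrow> (\<exists>i \<theta> B. Rule p i \<theta> B \<in> P \<and> q \<in> atoms_of B)"

definition two_partition :: "'a set \<Rightarrow> 'a set \<Rightarrow> bool" where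
  "two_partition A\<^sub>1 A\<^sub>2 \<longleftrightarrow> A\<^sub>1 \<union> A\<^sub>2 = UNIV \<and> A\<^sub>1 \<inter> A\<^sub>2 = {}"

definition program_stratifiable :: "('c, 'a, 'v) rule set \<Rightarrow> 'a set \<Rightarrow> 'a set \<Rightarrow> bool" where
  "program_stratifiable P A\<^sub>1 A\<^sub>2 \<longleftrightarrow>
     (\<forall>i < 2. \<forall>j < 2. \<forall>p q. depends P q p \<and> q \<in> [A\<^sub>1, A\<^sub>2] ! i \<and> p \<in> [A\<^sub>1, A\<^sub>2] ! j \<longrightarrow> i \<le> j)"

text \<open>The second block does not occur on the right-hand side: only the lower block is constrained.\<close>

definition operator_stratifiable ::
    "(('a, 'v) interp \<times> ('a, 'v) interp \<Rightarrow> ('a, 'v) interp \<times> ('a, 'v) interp) \<Rightarrow>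
     'a set \<Rightarrow> 'a set \<Rightarrow> bool" where
  "operator_stratifiable T A\<^sub>1 A\<^sub>2 \<longleftrightarrow>
     (\<forall>L\<^sub>1 U\<^sub>1 L\<^sub>2 U\<^sub>2. restrict_pair (L\<^sub>1, U\<^sub>1) A\<^sub>1 = restrict_pair (L\<^sub>2, U\<^sub>2) A\<^sub>1 \<longrightarrow>
        restrict_pair (T (L\<^sub>1, U\<^sub>1)) A\<^sub>1 = restrict_pair (T (L\<^sub>2, U\<^sub>2)) A\<^sub>1)"

end

theory Submission
  imports Defs
begin

text \<open>The value of \<open>T_op\<close> at an atom \<open>p\<close> depends on the pair of
  interpretations only through the atoms in bodies of rules with head \<open>p\<close>
  (\<open>consequence_cong\<close>). Stratifiability makes the lower block closed under dependency:
  if \<open>p\<close> lies in it, so do all those atoms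
  (\<open>program_stratifiable_lower_closed\<close>). Hence two pairs that agree on the lower block
  produce the same values there.\<close>

lemma restrict_eq_iff: "restrict f A = restrict g A \<longleftrightarrow> (\<forall>x\<in>A. f x = g x)"
  by (auto simp: restrict_def fun_eq_iff)

lemma restrict_pair_eq_iff:
  "restrict_pair (L\<^sub>1, U\<^sub>1) A = restrict_pair (L\<^sub>2, U\<^sub>2) A \<longleftrightarrow>
     (\<forall>p\<in>A. L\<^sub>1 p = L\<^sub>2 p) \<and> (\<forall>p\<in>A. U\<^sub>1 p = U\<^sub>2 p)"
  by (simp add: restrict_pair_def restrict_eq_iff)

text \<open>\<open>atoms_of\<close> does not record polarity, whereas \<open>Atom\<close> reads the
  first component and \<open>NegAtom\<close> the second; agreement is therefore assumed for both
  components at every atom. This symmetry lets the result serve the swapped pair as well.\<close>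

lemma eval_formula_cong:
  assumes "\<And>p. p \<in> atoms_of \<phi> \<Longrightarrow> L\<^sub>1 p = L\<^sub>2 p"
    and "\<And>p. p \<in> atoms_of \<phi> \<Longrightarrow> U\<^sub>1 p = U\<^sub>2 p"
  shows "eval_formula \<L> (L\<^sub>1, U\<^sub>1) \<phi> = eval_formula \<L> (L\<^sub>2, U\<^sub>2) \<phi>"
  using assms
proof (induction \<phi>)
  case (Conn f \<phi>s)
  have "map (eval_formula \<L> (L\<^sub>1, U\<^sub>1)) \<phi>s = map (eval_formula \<L> (L\<^sub>2, U\<^sub>2)) \<phi>s"
    using Conn by (intro map_cong) auto
  then show ?case by (simp only: eval_formula.simps)
qed auto

text \<open>Every rule with head \<open>p\<close> contributes the same value under both pairs, so
  the two suprema range over the same set.\<close>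

lemma consequence_cong:
  assumes "\<And>q. depends P q p \<Longrightarrow> L\<^sub>1 q = L\<^sub>2 q"
    and "\<And>q. depends P q p \<Longrightarrow> U\<^sub>1 q = U\<^sub>2 q"
  shows "consequence \<L> P (L\<^sub>1, U\<^sub>1) p = consequence \<L> P (L\<^sub>2, U\<^sub>2) p"
proof -
  have "eval_formula \<L> (L\<^sub>1, U\<^sub>1) B = eval_formula \<L> (L\<^sub>2, U\<^sub>2) B" if "Rule p i \<theta> B \<in> P" for i \<theta> B
    using that by (intro eval_formula_cong assms) (auto simp: depends_def)
  then show ?thesis
    unfolding consequence_def by (intro arg_cong[where f = Sup] Collect_cong) metis
qed

text \<open>Otherwise \<open>q\<close> would lie in the upper block, since the blocks cover all
  atoms, and stratifiability with block indices \<open>i = 1\<close> and \<open>j = 0\<close> would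
  force \<open>1 \<le> 0\<close>.\<close>

lemma program_stratifiable_lower_closed:
  assumes "two_partition A\<^sub>1 A\<^sub>2" and "program_stratifiable P A\<^sub>1 A\<^sub>2"
    and "depends P q p" and "p \<in> A\<^sub>1"
  shows "q \<in> A\<^sub>1"
proof (rule ccontr)
  assume "q \<notin> A\<^sub>1"
  then have "q \<in> [A\<^sub>1, A\<^sub>2] ! 1"
    using assms(1) by (auto simp: two_partition_def)
  moreover have "p \<in> [A\<^sub>1, A\<^sub>2] ! 0"
    using assms(4) by simp
  ultimately have "(1::nat) \<le> 0"
    using assms(2,3) unfolding program_stratifiable_def
    by (meson one_less_numeral_iff semiring_norm(76) zero_less_numeral)
  then show False by simp
qed

theorem theorem10:
  fixes \<L> :: "('c, 'v::complete_lattice) fuzzy_language"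
    and P :: "('c, 'a, 'v) rule set"
    and \<Pi>\<^sub>1 \<Pi>\<^sub>2 :: "'a set"
  assumes "fuzzy_language \<L>"
    and "normal_fuzzy_program \<L> P"
    and "two_partition \<Pi>\<^sub>1 \<Pi>\<^sub>2"
    and "program_stratifiable P \<Pi>\<^sub>1 \<Pi>\<^sub>2"
  shows "operator_stratifiable (T_op \<L> P) \<Pi>\<^sub>1 \<Pi>\<^sub>2"
proof -
  have "q \<in> \<Pi>\<^sub>1" if "depends P q p" "p \<in> \<Pi>\<^sub>1" for p q
    using program_stratifiable_lower_closed[OF assms(3,4) that] .
  then have "consequence \<L> P (L\<^sub>1, U\<^sub>1) p = consequence \<L> P (L\<^sub>2, U\<^sub>2) p"
    if "\<forall>q\<in>\<Pi>\<^sub>1. L\<^sub>1 q = L\<^sub>2 q" "\<forall>q\<in>\<Pi>\<^sub>1. U\<^sub>1 q = U\<^sub>2 q" "p \<in> \<Pi>\<^sub>1" for L\<^sub>1 U\<^sub>1 L\<^sub>2 U\<^sub>2 p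
    using that by (intro consequence_cong) auto
  \<comment> \<open>The second component of \<open>T_op\<close> is \<open>consequence\<close> at the
    swapped pair, so the fact just shown is used twice, the second time with the roles of
    \<open>L\<close> and \<open>U\<close> exchanged.\<close>
  then show ?thesis
    by (simp add: operator_stratifiable_def T_op_def restrict_pair_eq_iff)
qed

end
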